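(* Let $D=(E,S)$ be an arbitrary binary delta-matroid and let $a,b\in E$ be arbitrary distinct elements of its ground set. Then $$Q(D)-Q(D'_{ab})-Q(\widetilde D_{ab})+Q(\widetilde D'_{ab})=0,$$ where $Q$ is the transition polynomial (with parameters $s,t,-t$) $$Q(D)=\sum_{E=\Phi\sqcup X\sqcup\Psi}s^{|\Phi|}\,t^{|X|}\,(-t)^{|\Psi|}\,x^{d^0_{D+\Phi*X\overline{*}\Psi}},$$ the sum being over all partitions of the ground set $E$ into three disjoint (possibly empty) parts $\Phi,X,\Psi$, $D'_{ab}$ is the result of the first Vassiliev move, $\widetilde D_{ab}$ is the result of the second Vassiliev move, and $\widetilde D'_{ab}$ is the result of applying both moves.
   Context: A set system is a pair $(E,S)$ with $E$ a finite set and $S\subset 2^E$; elements of $S$ are called feasible sets. $\Delta$ denotes symmetric difference. A delta-matroid is a set system with $S\ne\emptyset$ such that for any $X,Y\in S$ and any $a\in X\Delta Y$ there is $b\in X\Delta Y$ (possibly $b=a$) with $X\Delta\{a,b\}\in S$. Binary delta-matroids. For a finite simple graph $G$, $D(G)$ is the delta-matroid with ground set the vertex set $V(G)$ in which $A\subset V(G)$ is feasible iff the adjacency matrix of the subgraph of $G$ induced by $A$ is nondegenerate over $\mathbb F_2$; the empty set is feasible by definition. A delta-matroid is graphic if it equals $D(G)$ for some such graph $G$. For $A\subset E$, the partial dual is $(E,S)*A=(E,\{F\subset E: F\Delta A\in S\})$. A delta-matroid $D$ is binary if there are a graphic delta-matroid $D_0=(E,S_0)$ and a set $A\subset E$ with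 $D=D_0*A$. Operations (applied from left to right), for $u\in E$: $D*u=D*\{u\}$; loop complementation $D+u=(E,\,S\,\Delta\,\{F\cup\{u\}: F\in S,\ u\notin F\})$; dual pivot $D\overline{*}u=D+u*u+u$ $(=D*u+u*u)$. The operations are extended to subsets $A\subset E$ by applying them to all elements of $A$ successively (operations on distinct elements commute), so $D\overline{*}A=D+A*A+A=D*A+A*A$. $d^0_D$ denotes the cardinality of a smallest feasible set of $D$. Vassiliev moves, for distinct $a,b\in E$: the second Vassiliev move (sliding $a$ over $b$) is $\widetilde D_{ab}=(E,\widetilde S_{ab})$ with $\widetilde S_{ab}=S\,\Delta\,\{A\sqcup\{a\}: A\subset E\setminus\{a,b\},\ A\sqcup\{b\}\in S\}$; the first Vassiliev move (exchanging the ends of $a,b$) is $D'_{ab}=\widetilde{(D*b)}_{ab}*b$; and $\widetilde D'_{ab}=\widetilde{(D'_{ab})}_{ab}=(\widetilde D_{ab})'_{ab}$ (the two moves commute). *)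

theory Defs
  imports
    "HOL-Library.Z2"
    "HOL-Computational_Algebra.Polynomial"
    "Jordan_Normal_Form.Determinant"
    "Graph_Theory.Pair_Digraph"
begin

type_synonym 'a set_sys = "'a set \<times> 'a set set"

abbreviation ground :: "'a set_sys \<Rightarrow> 'a set" where
  "ground D \<equiv> fst D"

abbreviation feasible :: "'a set_sys \<Rightarrow> 'a set set" where
  "feasible D \<equiv> snd D"

definition set_system :: "'a set_sys \<Rightarrow> bool" where
  "set_system D \<longleftrightarrow> finite (ground D) \<and> feasible D \<subseteq> Pow (ground D)"

definition delta_matroid :: "'a set_sys \<Rightarrow> bool" where
  "delta_matroid D \<longleftrightarrow> set_system D \<and> feasible D \<noteq> {} \<and>
     (\<forall>X\<in>feasible D. \<forall>Y\<in>feasible D. \<forall>a\<in>sym_diff X Y.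
        \<exists>b\<in>sym_diff X Y. sym_diff X {a, b} \<in> feasible D)"


subsection \<open>Graphic and binary delta-matroids\<close>

text \<open>Finite simple graphs are the \<^locale>\<open>pair_graph\<close>s: finite, loopless, symmetric
  digraphs whose arcs are ordered pairs of vertices; \<open>u\<close> and \<open>v\<close> are adjacent iff
  \<open>(u, v) \<in> parcs G\<close>.\<close>

text \<open>The adjacency matrix over the two-element field of the subgraph induced by the vertices
  in a list, with rows and columns in the order of that list.\<close>

definition adj_mat :: "'a pair_pre_digraph \<Rightarrow> 'a list \<Rightarrow> bit mat" where
  "adj_mat G vs = mat (length vs) (length vs)
     (\<lambda>(i, j). if (vs ! i, vs ! j) \<in> parcs G then 1 else 0)"

text \<open>Reordering the vertices permutes rows and columns simultaneously, so the choice of the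
  list \<open>vs\<close> enumerating \<open>A\<close> is immaterial.\<close>

definition graph_sys :: "'a pair_pre_digraph \<Rightarrow> 'a set_sys" where
  "graph_sys G = (pverts G,
     {A. A \<subseteq> pverts G \<and>
         (A = {} \<or> (\<exists>vs. distinct vs \<and> set vs = A \<and> det (adj_mat G vs) \<noteq> 0))})"

definition graphic :: "'a set_sys \<Rightarrow> bool" where
  "graphic D \<longleftrightarrow> delta_matroid D \<and> (\<exists>G. pair_graph G \<and> D = graph_sys G)"

definition partial_dual :: "'a set_sys \<Rightarrow> 'a set \<Rightarrow> 'a set_sys" where
  "partial_dual D A = (ground D, {F. F \<subseteq> ground D \<and> sym_diff F A \<in> feasible D})"

definition binary_delta_matroid :: "'a set_sys \<Rightarrow> bool" where
  "binary_delta_matroid D \<longleftrightarrow> delta_matroid D \<and>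
     (\<exists>D0 A. graphic D0 \<and> A \<subseteq> ground D0 \<and> D = partial_dual D0 A)"


subsection \<open>Loop complementation and dual pivot\<close>

definition loop_compl :: "'a set_sys \<Rightarrow> 'a \<Rightarrow> 'a set_sys" where
  "loop_compl D u = (ground D,
     sym_diff (feasible D) {F \<union> {u} | F. F \<in> feasible D \<and> u \<notin> F})"

definition dual_pivot :: "'a set_sys \<Rightarrow> 'a \<Rightarrow> 'a set_sys" where
  "dual_pivot D u = loop_compl (partial_dual (loop_compl D u) {u}) u"

text \<open>Successive application to the elements of a finite set. The order does not matter:
  see \<open>loop_compl_set_insert\<close> and \<open>dual_pivot_set_eq\<close> below.\<close>

definition loop_compl_set :: "'a set_sys \<Rightarrow> 'a set \<Rightarrow> 'a set_sys" where
  "loop_compl_set D A = Finite_Set.fold (\<lambda>u D'. loop_compl D' u) D A"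

definition dual_pivot_set :: "'a set_sys \<Rightarrow> 'a set \<Rightarrow> 'a set_sys" where
  "dual_pivot_set D A = Finite_Set.fold (\<lambda>u D'. dual_pivot D' u) D A"

lemma mem_loop_compl:
  "F \<in> feasible (loop_compl D u) \<longleftrightarrow>
     (F \<in> feasible D) \<noteq> (u \<in> F \<and> F - {u} \<in> feasible D)"
proof -
  have "(\<exists>F'. F = F' \<union> {u} \<and> F' \<in> feasible D \<and> u \<notin> F') \<longleftrightarrow> u \<in> F \<and> F - {u} \<in> feasible D"
    by (auto intro!: exI[of _ "F - {u}"])
  then show ?thesis
    by (auto simp: loop_compl_def)
qed

lemma ground_loop_compl [simp]: "ground (loop_compl D u) = ground D"
  by (simp add: loop_compl_def)

lemma ground_partial_dual [simp]: "ground (partial_dual D A) = ground D"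
  by (simp add: partial_dual_def)

lemma mem_partial_dual:
  "F \<in> feasible (partial_dual D A) \<longleftrightarrow> F \<subseteq> ground D \<and> sym_diff F A \<in> feasible D"
  by (simp add: partial_dual_def)

lemma set_sys_eqI:
  assumes "ground D = ground D'" "\<And>F. F \<in> feasible D \<longleftrightarrow> F \<in> feasible D'"
  shows "D = D'"
  using assms by (simp add: prod_eq_iff set_eq_iff)

lemma loop_compl_commute: "loop_compl (loop_compl D u) v = loop_compl (loop_compl D v) u"
proof (rule set_sys_eqI)
  fix F
  have "F - {u} - {v} = F - {v} - {u}" by auto
  then show "F \<in> feasible (loop_compl (loop_compl D u) v) \<longleftrightarrow>
      F \<in> feasible (loop_compl (loop_compl D v) u)"
    by (auto simp: mem_loop_compl)
qed simp

lemma loop_compl_partial_dual_commute: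
  assumes "v \<in> ground D" "v \<notin> A"
  shows "loop_compl (partial_dual D A) v = partial_dual (loop_compl D v) A"
proof (rule set_sys_eqI)
  fix F
  have "sym_diff (F - {v}) A = sym_diff F A - {v}" using assms by auto
  then show "F \<in> feasible (loop_compl (partial_dual D A) v) \<longleftrightarrow>
      F \<in> feasible (partial_dual (loop_compl D v) A)"
    using assms by (auto simp: mem_loop_compl mem_partial_dual)
qed simp

lemma partial_dual_partial_dual:
  assumes "A \<subseteq> ground D" "B \<subseteq> ground D"
  shows "partial_dual (partial_dual D A) B = partial_dual D (sym_diff A B)"
proof (rule set_sys_eqI)
  fix F
  have "sym_diff (sym_diff F B) A = sym_diff F (sym_diff A B)" by auto
  then show "F \<in> feasible (partial_dual (partial_dual D A) B) \<longleftrightarrow>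
      F \<in> feasible (partial_dual D (sym_diff A B))"
    using assms by (auto simp: mem_partial_dual)
qed simp

lemma comp_fun_commute_loop_compl:
  "comp_fun_commute_on UNIV (\<lambda>u D. loop_compl D u)"
  by standard (auto simp: fun_eq_iff loop_compl_commute)

lemma loop_compl_set_empty [simp]: "loop_compl_set D {} = D"
  by (simp add: loop_compl_set_def)

lemma loop_compl_set_insert:
  assumes "finite A" "u \<notin> A"
  shows "loop_compl_set D (insert u A) = loop_compl (loop_compl_set D A) u"
  unfolding loop_compl_set_def
  using comp_fun_commute_on.fold_insert[OF comp_fun_commute_loop_compl _ assms] by simp

lemma ground_loop_compl_set [simp]: "finite A \<Longrightarrow> ground (loop_compl_set D A) = ground D"
  by (induction A rule: finite_induct) (auto simp: loop_compl_set_insert)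

lemma loop_compl_set_loop_compl:
  "finite A \<Longrightarrow> loop_compl_set (loop_compl D u) A = loop_compl (loop_compl_set D A) u"
  by (induction A rule: finite_induct) (auto simp: loop_compl_set_insert loop_compl_commute)

lemma loop_compl_set_partial_dual_commute:
  assumes "finite A" "A \<subseteq> ground D" "A \<inter> B = {}"
  shows "loop_compl_set (partial_dual D B) A = partial_dual (loop_compl_set D A) B"
  using assms
  by (induction A rule: finite_induct)
    (auto simp: loop_compl_set_insert loop_compl_partial_dual_commute)

lemma dual_pivot_set_eq:
  assumes "set_system D" "A \<subseteq> ground D"
  shows "dual_pivot_set D A = loop_compl_set (partial_dual (loop_compl_set D A) A) A"
proof -
  let ?g = "\<lambda>A. loop_compl_set (partial_dual (loop_compl_set D A) A) A"
  have uniq: "y = ?g A"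
    if "fold_graph (\<lambda>u D'. dual_pivot D' u) D A y" "A \<subseteq> ground D" for y A
    using that
  proof (induction rule: fold_graph.induct)
    case emptyI
    show ?case
      by (rule set_sys_eqI) (use assms in \<open>auto simp: mem_partial_dual set_system_def\<close>)
  next
    case (insertI u A y)
    let ?L = loop_compl and ?LA = "\<lambda>D. loop_compl_set D A" and ?P = partial_dual
    let ?Z = "?P (loop_compl_set D (insert u A)) A"
    from insertI assms have u: "u \<in> ground D" "u \<notin> A" "A \<subseteq> ground D" and fin: "finite A"
      by (auto simp: set_system_def intro: finite_subset)
    have "?L y u = ?LA (?L (?P (?LA D) A) u)"
      using insertI u fin by (simp add: loop_compl_set_loop_compl)
    also have "?L (?P (?LA D) A) u = ?Z"
      using u fin by (simp add: loop_compl_partial_dual_commute loop_compl_set_insert)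
    finally have "?P (?L y u) {u} = ?LA (?P ?Z {u})"
      using u fin by (simp add: loop_compl_set_partial_dual_commute)
    also have "?P ?Z {u} = ?P (loop_compl_set D (insert u A)) (insert u A)"
    proof -
      have "sym_diff A {u} = insert u A" using u by auto
      then show ?thesis using u fin by (subst partial_dual_partial_dual) auto
    qed
    finally show ?case
      using u fin by (simp add: dual_pivot_def loop_compl_set_insert)
  qed
  have "finite A" using assms by (auto simp: set_system_def intro: finite_subset)
  then obtain y where "fold_graph (\<lambda>u D'. dual_pivot D' u) D A y"
    using finite_imp_fold_graph[of A "\<lambda>u D'. dual_pivot D' u" D] by blast
  with uniq[OF _ assms(2)] have "(THE y. fold_graph (\<lambda>u D'. dual_pivot D' u) D A y) = ?g A"
    by (metis (no_types, lifting) the_equality)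
  with \<open>finite A\<close> show ?thesis
    by (simp add: dual_pivot_set_def Finite_Set.fold_def)
qed


subsection \<open>The transition polynomial\<close>

text \<open>The number \<open>d\<^sup>0\<close>; meaningful for finite, nonempty \<open>feasible D\<close>.
  All set systems obtained below from a delta-matroid have this property, since the operations
  involved are bijections on the set systems with a given ground set and fix the one without
  feasible sets.\<close>

definition min_feasible_card :: "'a set_sys \<Rightarrow> nat" where
  "min_feasible_card D = Min (card ` feasible D)"

text \<open>The polynomial variable is \<open>x\<close>; the parameters \<open>s\<close>, \<open>t\<close> are arbitrary elements of
  a commutative ring and may themselves be indeterminates (e.g. with coefficients in
  \<^typ>\<open>int poly poly\<close>).\<close>

definition transition_poly :: "'r::comm_ring_1 \<Rightarrow> 'r \<Rightarrow> 'a set_sys \<Rightarrow> 'r poly" where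
  "transition_poly s t D =
     (\<Sum>(\<Phi>, X, \<Psi>) \<in> {(\<Phi>, X, \<Psi>). \<Phi> \<union> X \<union> \<Psi> = ground D \<and>
           \<Phi> \<inter> X = {} \<and> \<Phi> \<inter> \<Psi> = {} \<and> X \<inter> \<Psi> = {}}.
        monom (s ^ card \<Phi> * t ^ card X * (- t) ^ card \<Psi>)
          (min_feasible_card
            (dual_pivot_set (partial_dual (loop_compl_set D \<Phi>) X) \<Psi>)))"


subsection \<open>Vassiliev moves\<close>

definition second_move :: "'a set_sys \<Rightarrow> 'a \<Rightarrow> 'a \<Rightarrow> 'a set_sys" where
  "second_move D a b = (ground D,
     sym_diff (feasible D)
       {A \<union> {a} | A. A \<subseteq> ground D - {a, b} \<and> A \<union> {b} \<in> feasible D})"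

definition first_move :: "'a set_sys \<Rightarrow> 'a \<Rightarrow> 'a \<Rightarrow> 'a set_sys" where
  "first_move D a b = partial_dual (second_move (partial_dual D {b}) a b) {b}"

definition both_moves :: "'a set_sys \<Rightarrow> 'a \<Rightarrow> 'a \<Rightarrow> 'a set_sys" where
  "both_moves D a b = second_move (first_move D a b) a b"

end

theory Submission
  imports Defs
begin

text \<open>Write the indicator of the feasible sets, restricted to the sets that agree outside
  \<open>{a, b}\<close>, as a vector \<open>(x\<^sub>0, x\<^sub>a, x\<^sub>b, x\<^sub>a\<^sub>b)\<close> over the two-element field. The second move is
  \<open>x\<^sub>a := x\<^sub>a + x\<^sub>b\<close>, the first move is \<open>x\<^sub>a\<^sub>b := x\<^sub>a\<^sub>b + x\<^sub>0\<close>, and such a substitution leaves the smallest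
  cardinality of a feasible set unchanged if, after the twist by \<open>X \<union> \<Psi>\<close>, it adds the entry of a
  set to that of a set that is at least as large. Hence a partition contributes zero to the
  alternating sum if \<open>a\<close> or \<open>b\<close> lies in \<open>\<Phi>\<close> (the first move is invisible) or \<open>b\<close> lies in \<open>X\<close>
  (the second move is invisible). In the remaining case \<open>b \<in> \<Psi>\<close>, and shifting \<open>a\<close> between \<open>X\<close> and
  \<open>\<Psi>\<close> exchanges the exponents for \<open>D\<close> and \<open>both_moves D a b\<close>, and those for the two single moves,
  while the weight changes its sign.\<close>

subsection \<open>The moves as substitutions\<close>

lemma set_system_loop_compl:
  assumes "set_system D" "u \<in> ground D"
  shows "set_system (loop_compl D u)"
  using assms by (auto simp: set_system_def loop_compl_def)

lemma set_system_loop_compl_set: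
  assumes "set_system D" "finite A" "A \<subseteq> ground D"
  shows "set_system (loop_compl_set D A)"
  using assms(2,3,1)
  by (induction A rule: finite_induct) (auto simp: loop_compl_set_insert set_system_loop_compl)

lemma ground_second_move [simp]: "ground (second_move D a b) = ground D"
  by (simp add: second_move_def)

lemma ground_first_move [simp]: "ground (first_move D a b) = ground D"
  by (simp add: first_move_def)

text \<open>Feasible sets lie in the ground set, so the bound on \<open>A\<close> in the definition
  reduces to \<open>a \<notin> A\<close> and \<open>b \<notin> A\<close>, with
  \<open>A = F - {a}\<close>.\<close>

lemma mem_second_move:
  assumes "set_system D" "a \<noteq> b"
  shows "F \<in> feasible (second_move D a b) \<longleftrightarrow>
    (F \<in> feasible D) \<noteq> (a \<in> F \<and> b \<notin> F \<and> insert b (F - {a}) \<in> feasible D)"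
proof -
  have "F \<in> {A \<union> {a} | A. A \<subseteq> ground D - {a, b} \<and> A \<union> {b} \<in> feasible D} \<longleftrightarrow>
      a \<in> F \<and> b \<notin> F \<and> insert b (F - {a}) \<in> feasible D" (is "?l \<longleftrightarrow> ?r")
  proof
    assume ?l
    then obtain A where A: "F = A \<union> {a}" "A \<subseteq> ground D - {a, b}" "A \<union> {b} \<in> feasible D" by auto
    moreover have "insert b (F - {a}) = A \<union> {b}" using A by auto
    ultimately show ?r using assms by auto
  next
    assume ?r
    moreover from this have "insert b (F - {a}) \<subseteq> ground D"
      using assms by (auto simp: set_system_def)
    ultimately show ?l by (auto intro!: exI[of _ "F - {a}"])
  qed
  then show ?thesis
    unfolding second_move_def by (auto simp del: mem_Collect_eq)
qed

lemma set_system_second_move: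
  assumes "set_system D" "a \<in> ground D"
  shows "set_system (second_move D a b)"
  using assms by (auto simp: set_system_def second_move_def)

text \<open>Twisting by \<open>b\<close> exchanges \<open>x\<^sub>a\<close> with
  \<open>x\<^sub>a\<^sub>b\<close> and \<open>x\<^sub>b\<close> with \<open>x\<^sub>0\<close>, so
  adding \<open>x\<^sub>b\<close> to \<open>x\<^sub>a\<close> becomes adding
  \<open>x\<^sub>0\<close> to \<open>x\<^sub>a\<^sub>b\<close>.\<close>

lemma mem_first_move:
  assumes "set_system D" "a \<in> ground D" "b \<in> ground D" "a \<noteq> b"
  shows "F \<in> feasible (first_move D a b) \<longleftrightarrow>
    (F \<in> feasible D) \<noteq> (a \<in> F \<and> b \<in> F \<and> F - {a, b} \<in> feasible D)"
proof -
  have "set_system (partial_dual D {b})"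
    using assms by (auto simp: set_system_def mem_partial_dual)
  note mem = mem_second_move[OF this \<open>a \<noteq> b\<close>]
  have eq: "sym_diff (sym_diff F {b}) {b} = F" by auto
  have eq': "sym_diff (insert b (sym_diff F {b} - {a})) {b} = F - {a, b}" if "b \<in> F"
    using that assms by auto
  have sub: "F \<subseteq> ground D" if "F \<in> feasible D" for F
    using that assms by (auto simp: set_system_def)
  have ins: "insert b (sym_diff F {b} - {a}) \<subseteq> ground D" "sym_diff F {b} \<subseteq> ground D"
    if "F \<subseteq> ground D" using that assms by auto
  have sub': "F \<subseteq> ground D" if "F - {a, b} \<in> feasible D"
    using sub[OF that] assms by auto
  have *: "a \<in> sym_diff F {b} \<longleftrightarrow> a \<in> F" "b \<notin> sym_diff F {b} \<longleftrightarrow> b \<in> F" using assms by auto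
  show ?thesis
    unfolding first_move_def mem_partial_dual mem ground_partial_dual ground_second_move * eq
    using eq' sub sub' ins by metis
qed

lemma set_system_first_move:
  assumes "set_system D"
  shows "set_system (first_move D a b)"
  using assms by (auto simp: set_system_def first_move_def mem_partial_dual)

section \<open>Relations among the two moves and loop complementation\<close>

context
  fixes D :: "'a set_sys" and a b :: 'a
  assumes D: "set_system D" and a: "a \<in> ground D" and b: "b \<in> ground D" and ab: "a \<noteq> b"
begin

lemma second_move_second_move: "second_move (second_move D a b) a b = D"
  by (rule set_sys_eqI) (use ab in \<open>auto simp: mem_second_move D a set_system_second_move\<close>)

lemma first_move_first_move: "first_move (first_move D a b) a b = D"
  by (rule set_sys_eqI) (auto simp: mem_first_move D a b ab set_system_first_move)

text \<open>One move reads \<open>x\<^sub>b\<close> and writes \<open>x\<^sub>a\<close>, the other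
  reads \<open>x\<^sub>0\<close> and writes \<open>x\<^sub>a\<^sub>b\<close>; neither reads what the
  other writes.\<close>

lemma first_move_second_move: "first_move (second_move D a b) a b = both_moves D a b"
  unfolding both_moves_def
proof (rule set_sys_eqI)
  fix F
  have "insert b (F - {a}) - {a, b} = F - {a, b}" using ab by auto
  then show "F \<in> feasible (first_move (second_move D a b) a b) \<longleftrightarrow>
      F \<in> feasible (second_move (first_move D a b) a b)"
    using ab a b by (auto simp: mem_first_move mem_second_move D set_system_first_move
      set_system_second_move)
qed simp

text \<open>Loop complementation at \<open>a\<close> or \<open>b\<close> neither changes
  \<open>x\<^sub>0\<close> nor reads \<open>x\<^sub>a\<^sub>b\<close>; at any other \<open>c\<close>
  it treats the four entries alike.\<close>

lemma loop_compl_first_move: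
  assumes "c \<in> ground D"
  shows "loop_compl (first_move D a b) c = first_move (loop_compl D c) a b"
proof (rule set_sys_eqI)
  fix F
  have "F - {c} - {a, b} = F - {a, b} - {c}" by auto
  then show "F \<in> feasible (loop_compl (first_move D a b) c) \<longleftrightarrow>
      F \<in> feasible (first_move (loop_compl D c) a b)"
    using ab a b assms by (auto simp: mem_first_move mem_loop_compl D set_system_loop_compl)
qed simp

text \<open>Loop complementation at \<open>a\<close> neither changes \<open>x\<^sub>b\<close> nor
  reads \<open>x\<^sub>a\<close>. At \<open>b\<close> it does both, hence
  \<open>c \<noteq> b\<close>.\<close>

lemma loop_compl_second_move:
  assumes "c \<in> ground D" "c \<noteq> b"
  shows "loop_compl (second_move D a b) c = second_move (loop_compl D c) a b"
proof (rule set_sys_eqI)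
  fix F
  have "insert b (F - {c} - {a}) = insert b (F - {a}) - {c}" using assms by auto
  then show "F \<in> feasible (loop_compl (second_move D a b) c) \<longleftrightarrow>
      F \<in> feasible (second_move (loop_compl D c) a b)"
    using ab a b assms by (auto simp: mem_second_move mem_loop_compl D set_system_loop_compl)
qed simp

text \<open>The identity behind the exchange of exponents: both sides have the entries
  \<open>x\<^sub>0\<close>, \<open>x\<^sub>0 + x\<^sub>a + x\<^sub>b\<close>,
  \<open>x\<^sub>0 + x\<^sub>b\<close>, \<open>x\<^sub>a + x\<^sub>a\<^sub>b\<close>.\<close>

lemma loop_compl_both_moves:
  "loop_compl (loop_compl (both_moves D a b) a) b = second_move (loop_compl D b) a b"
  unfolding both_moves_def
proof (rule set_sys_eqI)
  fix F
  have eqs: "F - {b} - {a} = F - {a, b}" "F - {a} - {b} = F - {a, b}"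
    "insert b (F - {a}) - {b} = F - {a, b}" "insert b (F - {a, b}) = insert b (F - {a})"
    "insert b (F - {a}) - {a, b} = F - {a, b}"
    using ab by auto
  have eq': "insert b (F - {a}) = F - {a}" if "b \<in> F" using that ab by auto
  have eq'': "F - {a, b} = F - {a}" if "b \<notin> F" using that by auto
  note sys = set_system_loop_compl[OF D b] set_system_first_move[OF D, of a b]
  show "F \<in> feasible (loop_compl (loop_compl (second_move (first_move D a b) a b) a) b) \<longleftrightarrow>
      F \<in> feasible (second_move (loop_compl D b) a b)"
    unfolding mem_loop_compl mem_second_move[OF sys(1) ab] mem_second_move[OF sys(2) ab]
      mem_first_move[OF D a b ab]
    using ab eq' eq'' by (cases "a \<in> F"; cases "b \<in> F") (simp_all add: eqs, blast+)
qed simp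

lemma loop_compl_set_first_move:
  assumes "A \<subseteq> ground D"
  shows "loop_compl_set (first_move D a b) A = first_move (loop_compl_set D A) a b"
proof -
  have "finite A" using assms D by (auto simp: set_system_def intro: finite_subset)
  then show ?thesis
    using assms
  proof (induction A rule: finite_induct)
    case (insert c A)
    then show ?case
      \<comment> \<open>Commutation is applied to \<open>loop_compl_set D A\<close> rather than to
        the fixed \<open>D\<close>, hence the generalized fact.\<close>
      using Submission.loop_compl_first_move[OF set_system_loop_compl_set[OF D]] a b ab
      by (simp add: loop_compl_set_insert)
  qed simp
qed

lemma loop_compl_set_second_move:
  assumes "A \<subseteq> ground D - {b}"
  shows "loop_compl_set (second_move D a b) A = second_move (loop_compl_set D A) a b"
proof -
  have "finite A" using assms D by (auto simp: set_system_def intro: finite_subset)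
  then show ?thesis
    using assms
  proof (induction A rule: finite_induct)
    case (insert c A)
    moreover from insert have "A \<subseteq> ground D" "c \<in> ground D" "c \<noteq> b" by auto
    ultimately show ?case
      using Submission.loop_compl_second_move[OF set_system_loop_compl_set[OF D]] a b ab
      by (simp add: loop_compl_set_insert)
  qed simp
qed

end

subsection \<open>Invariance of the smallest cardinality\<close>

lemma Min_card_le:
  assumes "finite \<F>" "\<G> \<noteq> {}" "\<And>G. G \<in> \<G> \<Longrightarrow> \<exists>F\<in>\<F>. card F \<le> card G" "finite \<G>"
  shows "Min (card ` \<F>) \<le> Min (card ` \<G>)"
proof -
  have "Min (card ` \<G>) \<in> card ` \<G>" using assms by simp
  then obtain G where "G \<in> \<G>" "Min (card ` \<G>) = card G" by auto
  moreover from this assms(3) obtain F where "F \<in> \<F>" "card F \<le> card G" by blast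
  ultimately show ?thesis using assms(1) by (metis Min_le finite_imageI imageI order_trans)
qed

lemma min_feasible_card_eqI:
  assumes "set_system D" "set_system D'"
    and "\<And>F. F \<in> feasible D \<Longrightarrow> \<exists>F'\<in>feasible D'. card F' \<le> card F"
    and "\<And>F. F \<in> feasible D' \<Longrightarrow> \<exists>F'\<in>feasible D. card F' \<le> card F"
  shows "min_feasible_card D = min_feasible_card D'"
proof -
  have fin: "finite (feasible D)" "finite (feasible D')"
    using assms(1,2) by (meson finite_Pow_iff finite_subset set_system_def)+
  show ?thesis
  proof (cases "feasible D = {}")
    \<comment> \<open>\<open>Min {}\<close> has no specified value, but both sides are then this
      same term.\<close>
    case True
    then have "feasible D' = {}" using assms(4) by auto
    with True show ?thesis by (simp add: min_feasible_card_def)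
  next
    case False
    then have "feasible D' \<noteq> {}" using assms(3) by auto
    with False show ?thesis
      unfolding min_feasible_card_def by (intro antisym Min_card_le fin assms)
  qed
qed

text \<open>A set \<open>F\<close> changes its status only if \<open>F - {u}\<close> is feasible,
  and \<open>F - {u}\<close> keeps its own status.\<close>

lemma min_feasible_card_loop_compl:
  assumes "set_system D" "u \<in> ground D"
  shows "min_feasible_card (loop_compl D u) = min_feasible_card D"
proof (rule min_feasible_card_eqI)
  have card: "card (F - {u}) \<le> card F" for F by (rule card_Diff1_le)
  fix F
  show "\<exists>F'\<in>feasible D. card F' \<le> card F" if "F \<in> feasible (loop_compl D u)"
    using that card[of F] by (auto simp: mem_loop_compl)
  show "\<exists>F'\<in>feasible (loop_compl D u). card F' \<le> card F" if "F \<in> feasible D"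
  proof (cases "F \<in> feasible (loop_compl D u)")
    case False
    with that have "F - {u} \<in> feasible (loop_compl D u)" by (auto simp: mem_loop_compl)
    with card[of F] show ?thesis by blast
  qed auto
qed (use assms in \<open>simp_all add: set_system_loop_compl\<close>)

lemma min_feasible_card_loop_compl_set:
  assumes "set_system D" "finite A" "A \<subseteq> ground D"
  shows "min_feasible_card (loop_compl_set D A) = min_feasible_card D"
  using assms(2,3)
proof (induction A rule: finite_induct)
  case (insert u A)
  then show ?case
    using assms(1) by (simp add: loop_compl_set_insert min_feasible_card_loop_compl
      set_system_loop_compl_set)
qed simp

section \<open>Invariance under the moves after a twist\<close>

lemma set_system_partial_dual: "set_system D \<Longrightarrow> set_system (partial_dual D A)"
  by (auto simp: set_system_def mem_partial_dual)

text \<open>At least one element is removed and at most one is added.\<close>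

lemma card_sym_diff_pair_le:
  assumes "finite F" "a \<in> F \<or> b \<in> F"
  shows "card (sym_diff F {a, b}) \<le> card F"
proof -
  have "card (sym_diff F {a, b}) \<le> card (insert y (F - {x}))" if "x \<in> F" "{x, y} = {a, b}" for x y
    using assms(1) that by (intro card_mono) auto
  also have "card (insert y (F - {x})) \<le> card F" if "x \<in> F" for x y
    using assms(1) that by (metis card.remove card_insert_le_m1 diff_Suc_1 le_refl card_gt_0_iff empty_iff)
  finally show ?thesis using assms(2) by (meson doubleton_eq_iff)
qed

text \<open>Covers both moves, which toggle \<open>H\<close> according to the status of
  \<open>sym_diff H {a, b}\<close>. The twist by \<open>Y\<close> turns \<open>H\<close> into
  \<open>sym_diff H Y\<close>; if that meets \<open>{a, b}\<close>, flipping \<open>a\<close> and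
  \<open>b\<close> gives a replacement in the other system that is no larger.\<close>

lemma min_feasible_card_dual_eqI:
  assumes "set_system D" "set_system D'" "ground D' = ground D" "a \<in> ground D" "b \<in> ground D"
    and "\<And>H. \<lbrakk>H \<in> feasible D; H \<notin> feasible D'\<rbrakk> \<Longrightarrow>
      sym_diff H {a, b} \<in> feasible D' \<and> (a \<in> sym_diff H Y \<or> b \<in> sym_diff H Y)"
    and "\<And>H. \<lbrakk>H \<in> feasible D'; H \<notin> feasible D\<rbrakk> \<Longrightarrow>
      sym_diff H {a, b} \<in> feasible D \<and> (a \<in> sym_diff H Y \<or> b \<in> sym_diff H Y)"
  shows "min_feasible_card (partial_dual D Y) = min_feasible_card (partial_dual D' Y)"
proof -
  have *: "\<exists>F'\<in>feasible (partial_dual D' Y). card F' \<le> card F"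
    if F: "F \<in> feasible (partial_dual D Y)" and "set_system D" "ground D' = ground D"
      "a \<in> ground D" "b \<in> ground D"
      and step: "\<And>H. \<lbrakk>H \<in> feasible D; H \<notin> feasible D'\<rbrakk> \<Longrightarrow>
        sym_diff H {a, b} \<in> feasible D' \<and> (a \<in> sym_diff H Y \<or> b \<in> sym_diff H Y)"
    for D D' :: "'a set_sys" and F
  proof (cases "sym_diff F Y \<in> feasible D'")
    case True
    then show ?thesis using that by (auto simp: mem_partial_dual)
  next
    case False
    let ?F = "sym_diff F {a, b}"
    have "finite F" using that by (auto simp: mem_partial_dual set_system_def intro: finite_subset)
    have "sym_diff (sym_diff F Y) Y = F" "sym_diff (sym_diff F Y) {a, b} = sym_diff ?F Y" by auto
    with step[of "sym_diff F Y"] F False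
    have "sym_diff ?F Y \<in> feasible D'" "a \<in> F \<or> b \<in> F" by (auto simp: mem_partial_dual)
    with that card_sym_diff_pair_le[OF \<open>finite F\<close>] show ?thesis
      by (intro bexI[of _ ?F]) (auto simp: mem_partial_dual)
  qed
  show ?thesis
    by (intro min_feasible_card_eqI set_system_partial_dual assms(1,2)
      *[of _ D D'] *[of _ D' D] assms(6,7)) (simp_all add: assms(1-5))
qed

text \<open>Toggled sets contain \<open>a\<close> and \<open>b\<close>, and the twist leaves in
  place the one outside \<open>Y\<close>.\<close>

lemma min_feasible_card_first_move:
  assumes "set_system D" "a \<in> ground D" "b \<in> ground D" "a \<noteq> b" "a \<notin> Y \<or> b \<notin> Y"
  shows "min_feasible_card (partial_dual (first_move D a b) Y) = min_feasible_card (partial_dual D Y)"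
proof (rule min_feasible_card_dual_eqI[of _ _ a b])
  have eq: "sym_diff H {a, b} = H - {a, b}" if "a \<in> H" "b \<in> H" for H using that by auto
  fix H
  show "sym_diff H {a, b} \<in> feasible D \<and> (a \<in> sym_diff H Y \<or> b \<in> sym_diff H Y)"
    if "H \<in> feasible (first_move D a b)" "H \<notin> feasible D"
    using that assms eq[of H] by (auto simp: mem_first_move)
  show "sym_diff H {a, b} \<in> feasible (first_move D a b) \<and> (a \<in> sym_diff H Y \<or> b \<in> sym_diff H Y)"
    if "H \<notin> feasible (first_move D a b)" "H \<in> feasible D"
    using that assms eq[of H] by (auto simp: mem_first_move)
qed (use assms in \<open>simp_all add: set_system_first_move\<close>)

text \<open>Toggled sets contain \<open>a\<close> but not \<open>b\<close>, so the twist brings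
  \<open>b\<close> in.\<close>

lemma min_feasible_card_second_move:
  assumes "set_system D" "a \<in> ground D" "b \<in> ground D" "a \<noteq> b" "b \<in> Y"
  shows "min_feasible_card (partial_dual (second_move D a b) Y) = min_feasible_card (partial_dual D Y)"
proof (rule min_feasible_card_dual_eqI[of _ _ a b])
  have eq: "sym_diff H {a, b} = insert b (H - {a})" if "a \<in> H" "b \<notin> H" for H
    using that by auto
  fix H
  show "sym_diff H {a, b} \<in> feasible D \<and> (a \<in> sym_diff H Y \<or> b \<in> sym_diff H Y)"
    if "H \<in> feasible (second_move D a b)" "H \<notin> feasible D"
    using that assms eq[of H] by (auto simp: mem_second_move)
  show "sym_diff H {a, b} \<in> feasible (second_move D a b) \<and> (a \<in> sym_diff H Y \<or> b \<in> sym_diff H Y)"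
    if "H \<notin> feasible (second_move D a b)" "H \<in> feasible D"
    using that assms eq[of H] by (auto simp: mem_second_move)
qed (use assms in \<open>simp_all add: set_system_second_move\<close>)

subsection \<open>Exponents of the transition polynomial\<close>

definition transition_exp :: "'a set_sys \<Rightarrow> 'a set \<Rightarrow> 'a set \<Rightarrow> 'a set \<Rightarrow> nat" where
  "transition_exp D \<Phi> X \<Psi> =
     min_feasible_card (dual_pivot_set (partial_dual (loop_compl_set D \<Phi>) X) \<Psi>)"

definition partitions3 :: "'a set \<Rightarrow> ('a set \<times> 'a set \<times> 'a set) set" where
  "partitions3 E = {(\<Phi>, X, \<Psi>). \<Phi> \<union> X \<union> \<Psi> = E \<and> \<Phi> \<inter> X = {} \<and> \<Phi> \<inter> \<Psi> = {} \<and> X \<inter> \<Psi> = {}}"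

lemma finite_partitions3: "finite E \<Longrightarrow> finite (partitions3 E)"
  by (rule finite_subset[of _ "Pow E \<times> Pow E \<times> Pow E"]) (auto simp: partitions3_def)

text \<open>The dual pivot on \<open>\<Psi>\<close> is \<open>+\<Psi>*\<Psi>+\<Psi>\<close>. By
  disjointness the twists merge and \<open>+\<Phi>\<close> moves past them; there it and the last
  \<open>+\<Psi>\<close> do not affect the smallest cardinality.\<close>

lemma transition_exp_eq:
  assumes D: "set_system D" and part: "(\<Phi>, X, \<Psi>) \<in> partitions3 (ground D)"
  shows "transition_exp D \<Phi> X \<Psi> = min_feasible_card (partial_dual (loop_compl_set D \<Psi>) (X \<union> \<Psi>))"
proof -
  have sub: "\<Phi> \<subseteq> ground D" "X \<subseteq> ground D" "\<Psi> \<subseteq> ground D"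
    and disj: "\<Phi> \<inter> X = {}" "\<Phi> \<inter> \<Psi> = {}" "X \<inter> \<Psi> = {}"
    using part by (auto simp: partitions3_def)
  then have fin: "finite \<Phi>" "finite \<Psi>" using D by (auto simp: set_system_def intro: finite_subset)
  let ?D = "loop_compl_set D \<Phi>"
  have D': "set_system ?D" using D fin sub by (simp add: set_system_loop_compl_set)
  have swap: "loop_compl_set ?D \<Psi> = loop_compl_set (loop_compl_set D \<Psi>) \<Phi>"
    using fin(1) by (induction \<Phi> rule: finite_induct)
      (simp_all add: loop_compl_set_insert loop_compl_set_loop_compl fin)
  have "sym_diff X \<Psi> = X \<union> \<Psi>" using disj by auto
  then have "partial_dual (loop_compl_set (partial_dual ?D X) \<Psi>) \<Psi>
      = partial_dual (loop_compl_set ?D \<Psi>) (X \<union> \<Psi>)"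
    using sub fin disj by (simp add: loop_compl_set_partial_dual_commute partial_dual_partial_dual
      Int_commute)
  also have "\<dots> = loop_compl_set (partial_dual (loop_compl_set D \<Psi>) (X \<union> \<Psi>)) \<Phi>"
    unfolding swap using sub fin disj by (subst loop_compl_set_partial_dual_commute) auto
  finally have "transition_exp D \<Phi> X \<Psi> = min_feasible_card
      (loop_compl_set (loop_compl_set (partial_dual (loop_compl_set D \<Psi>) (X \<union> \<Psi>)) \<Phi>) \<Psi>)"
    using D' sub fin by (simp add: transition_exp_def dual_pivot_set_eq set_system_partial_dual)
  then show ?thesis
    using D sub fin by (simp add: min_feasible_card_loop_compl_set set_system_loop_compl_set
      set_system_partial_dual)
qed

section \<open>Effect of the moves on the exponents\<close>

context
  fixes D :: "'a set_sys" and a b :: 'a and \<Phi> X \<Psi> :: "'a set"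
  assumes D: "set_system D" and a: "a \<in> ground D" and b: "b \<in> ground D" and ab: "a \<noteq> b"
    and part: "(\<Phi>, X, \<Psi>) \<in> partitions3 (ground D)"
begin

lemma transition_exp_first_move:
  assumes "a \<in> \<Phi> \<or> b \<in> \<Phi>"
  shows "transition_exp (first_move D a b) \<Phi> X \<Psi> = transition_exp D \<Phi> X \<Psi>"
proof -
  have "\<Psi> \<subseteq> ground D" "a \<notin> X \<union> \<Psi> \<or> b \<notin> X \<union> \<Psi>" using part assms by (auto simp: partitions3_def)
  moreover from this have "finite \<Psi>" using D by (auto simp: set_system_def intro: finite_subset)
  ultimately show ?thesis
    using D a b ab part by (simp add: transition_exp_eq set_system_first_move
      loop_compl_set_first_move min_feasible_card_first_move set_system_loop_compl_set)
qed

text \<open>As \<open>b \<notin> \<Psi>\<close>, the move commutes with \<open>+\<Psi>\<close>, and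
  the twist set contains \<open>b\<close>.\<close>

lemma transition_exp_second_move:
  assumes "b \<in> X"
  shows "transition_exp (second_move D a b) \<Phi> X \<Psi> = transition_exp D \<Phi> X \<Psi>"
proof -
  have "\<Psi> \<subseteq> ground D - {b}" "\<Psi> \<subseteq> ground D" using part assms by (auto simp: partitions3_def)
  moreover from this have "finite \<Psi>" using D by (auto simp: set_system_def intro: finite_subset)
  ultimately show ?thesis
    using D a b ab part assms by (simp add: transition_exp_eq set_system_second_move
      loop_compl_set_second_move min_feasible_card_second_move set_system_loop_compl_set)
qed

text \<open>By \<open>loop_compl_both_moves\<close>, the left side is the exponent of a second move
  after \<open>+\<Psi>\<close>. The twist set stays \<open>X \<union> \<Psi>\<close> and contains
  \<open>b\<close>, so that move is invisible.\<close>

lemma transition_exp_both_moves: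
  assumes "a \<in> X" "b \<in> \<Psi>"
  shows "transition_exp (both_moves D a b) \<Phi> (X - {a}) (insert a \<Psi>) = transition_exp D \<Phi> X \<Psi>"
proof -
  let ?\<Psi> = "\<Psi> - {b}"
  have sub: "?\<Psi> \<subseteq> ground D - {b}" "\<Psi> \<subseteq> ground D" and [simp]: "a \<notin> \<Psi>"
    using part assms by (auto simp: partitions3_def)
  from sub have fin: "finite \<Psi>" using D by (auto simp: set_system_def intro: finite_subset)
  \<comment> \<open>\<open>b\<close> is split off for \<open>loop_compl_both_moves\<close>; the rest
    of \<open>\<Psi>\<close> commutes with the second move.\<close>
  have insert: "loop_compl_set D' \<Psi> = loop_compl (loop_compl_set D' ?\<Psi>) b" for D' :: "'a set_sys"
    using loop_compl_set_insert[of ?\<Psi> b D'] fin assms by (simp add: insert_absorb)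
  have "loop_compl_set (both_moves D a b) (insert a \<Psi>)
      = loop_compl_set (loop_compl (loop_compl (both_moves D a b) a) b) ?\<Psi>"
    using fin by (simp add: loop_compl_set_insert insert loop_compl_set_loop_compl
      loop_compl_commute)
  also have "\<dots> = loop_compl_set (second_move (loop_compl D b) a b) ?\<Psi>"
    using D a b ab by (simp add: loop_compl_both_moves)
  also have "\<dots> = second_move (loop_compl_set D \<Psi>) a b"
    using D a b ab sub fin by (simp add: loop_compl_set_second_move set_system_loop_compl insert
      loop_compl_set_loop_compl)
  finally have *: "loop_compl_set (both_moves D a b) (insert a \<Psi>)
      = second_move (loop_compl_set D \<Psi>) a b" .
  have "set_system (both_moves D a b)" "ground (both_moves D a b) = ground D"
    using D a by (simp_all add: both_moves_def set_system_first_move set_system_second_move)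
  moreover have "(\<Phi>, X - {a}, insert a \<Psi>) \<in> partitions3 (ground D)"
    using part assms by (auto simp: partitions3_def)
  moreover have "X - {a} \<union> insert a \<Psi> = X \<union> \<Psi>" using assms by auto
  ultimately show ?thesis
    using D a b ab part assms sub fin by (simp add: transition_exp_eq *
      min_feasible_card_second_move set_system_loop_compl_set del: Un_insert_right)
qed

end

section \<open>Cancellation in the alternating sum\<close>

lemma transition_poly_four_term:
  fixes D :: "'a set_sys" and s t :: "'r::comm_ring_1"
  assumes D: "set_system D" and a: "a \<in> ground D" and b: "b \<in> ground D" and ab: "a \<noteq> b"
  shows "transition_poly s t D - transition_poly s t (first_move D a b)
           - transition_poly s t (second_move D a b) + transition_poly s t (both_moves D a b) = 0"
proof -
  let ?P = "partitions3 (ground D)"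
  define w where "w \<Phi> X \<Psi> = s ^ card \<Phi> * t ^ card X * (- t) ^ card \<Psi>" for \<Phi> X \<Psi> :: "'a set"
  define m where "m D' = (\<lambda>(\<Phi>, X, \<Psi>). monom (w \<Phi> X \<Psi>) (transition_exp D' \<Phi> X \<Psi>))"
    for D' :: "'a set_sys"
  let ?D1 = "first_move D a b" and ?D2 = "second_move D a b" and ?D12 = "both_moves D a b"
  have sys: "set_system ?D1" "set_system ?D2" "set_system ?D12"
    and ground: "ground ?D12 = ground D"
    using D a by (simp_all add: both_moves_def set_system_first_move set_system_second_move)
  \<comment> \<open>The moves are commuting involutions, so applying both exchanges \<open>D\<close>
    with \<open>?D12\<close> and \<open>?D1\<close> with \<open>?D2\<close>.\<close>
  have both: "both_moves ?D1 a b = ?D2" "both_moves ?D2 a b = ?D1" "both_moves ?D12 a b = D"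
  proof -
    show "both_moves ?D1 a b = ?D2"
      using D a b ab by (simp add: both_moves_def first_move_first_move)
    show "both_moves ?D2 a b = ?D1"
      using first_move_second_move[OF sys(2), of a b] second_move_second_move[OF D a b ab] a b ab
      by simp
    have "first_move (second_move ?D12 a b) a b = D"
      using second_move_second_move[OF sys(1), of a b] first_move_first_move[OF D a b ab] a b ab
      by (simp add: both_moves_def)
    then show "both_moves ?D12 a b = D"
      using first_move_second_move[OF sys(3), of a b] a b ab ground by simp
  qed
  define T where "T p = m D p - m ?D1 p - m ?D2 p + m ?D12 p" for p
  have poly: "transition_poly s t D' = sum (m D') (partitions3 (ground D'))" for D' :: "'a set_sys"
    by (simp add: transition_poly_def partitions3_def m_def w_def transition_exp_def)
  have fin: "finite ?P" using D by (simp add: finite_partitions3 set_system_def)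
  \<comment> \<open>Only partitions in \<open>A\<close> and \<open>B\<close> may contribute;
    \<open>h\<close> shifts \<open>a\<close> from \<open>X\<close> to \<open>\<Psi>\<close>, a
    bijection from \<open>A\<close> to \<open>B\<close> with inverse \<open>h'\<close>.\<close>
  define A where "A = {(\<Phi>, X, \<Psi>) \<in> ?P. b \<in> \<Psi> \<and> a \<in> X}"
  define B where "B = {(\<Phi>, X, \<Psi>) \<in> ?P. b \<in> \<Psi> \<and> a \<in> \<Psi>}"
  define h where "h = (\<lambda>(\<Phi>, X, \<Psi>). (\<Phi> :: 'a set, X - {a}, insert a \<Psi>))"
  define h' where "h' = (\<lambda>(\<Phi>, X, \<Psi>). (\<Phi> :: 'a set, insert a X, \<Psi> - {a}))"
  have zero: "T p = 0" if p: "p \<in> ?P - (A \<union> B)" for p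
  proof -
    obtain \<Phi> X \<Psi> where [simp]: "p = (\<Phi>, X, \<Psi>)" by (cases p)
    have part: "(\<Phi>, X, \<Psi>) \<in> ?P" using p by simp
    have "a \<in> \<Phi> \<or> b \<in> \<Phi> \<or> b \<in> X" using p a b by (auto simp: A_def B_def partitions3_def)
    then consider "a \<in> \<Phi> \<or> b \<in> \<Phi>" | "b \<in> X" by blast
    then show ?thesis
    proof cases
      case 1
      \<comment> \<open>\<open>?D12\<close> is the first move of \<open>?D2\<close>, so
        \<open>D\<close> cancels with \<open>?D1\<close> and \<open>?D2\<close> with
        \<open>?D12\<close>.\<close>
      have "transition_exp ?D12 \<Phi> X \<Psi> = transition_exp ?D2 \<Phi> X \<Psi>"
        using transition_exp_first_move[of ?D2 a b \<Phi> X \<Psi>] 1 part sys D a b ab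
        by (simp add: first_move_second_move)
      with transition_exp_first_move[OF D a b ab part 1] show ?thesis
        by (simp add: T_def m_def)
    next
      case 2
      \<comment> \<open>\<open>?D12\<close> is the second move of \<open>?D1\<close>, so
        \<open>D\<close> cancels with \<open>?D2\<close> and \<open>?D1\<close> with
        \<open>?D12\<close>.\<close>
      have "transition_exp ?D12 \<Phi> X \<Psi> = transition_exp ?D1 \<Phi> X \<Psi>"
        using transition_exp_second_move[of ?D1 a b \<Phi> X \<Psi>] 2 part sys a b ab
        by (simp add: both_moves_def)
      with transition_exp_second_move[OF D a b ab part 2] show ?thesis
        by (simp add: T_def m_def)
    qed
  qed
  have flip: "T (h p) = - T p" if p: "p \<in> A" for p
  proof -
    obtain \<Phi> X \<Psi> where [simp]: "p = (\<Phi>, X, \<Psi>)" by (cases p)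
    have part: "(\<Phi>, X, \<Psi>) \<in> ?P" and mem: "a \<in> X" "b \<in> \<Psi>" using p by (auto simp: A_def)
    have "finite X" "finite \<Psi>" "a \<notin> \<Psi>"
      using D part mem by (auto simp: set_system_def partitions3_def intro: finite_subset)
    then have w: "w \<Phi> (X - {a}) (insert a \<Psi>) = - w \<Phi> X \<Psi>"
      using mem card_Suc_Diff1[of X a, symmetric] by (simp add: w_def mult_ac del: card_Diff_insert)
    \<comment> \<open>Systems exchanged by \<open>both_moves\<close> have equal signs in
      \<open>T\<close>, so the sign change of the weight carries over to \<open>T\<close>.\<close>
    have *: "m (both_moves D' a b) (h p) = - m D' p" if "set_system D'" "ground D' = ground D" for D'
      using transition_exp_both_moves[of D' a b \<Phi> X \<Psi>] that part mem a b ab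
      by (simp add: m_def h_def w minus_monom)
    show ?thesis
      using *[OF D refl] *[OF sys(1)] *[OF sys(2)] *[OF sys(3)] ground both by (simp add: T_def)
  qed
  have "h p \<in> B" "h' (h p) = p" if "p \<in> A" for p
    using that ab by (auto simp: A_def B_def h_def h'_def partitions3_def)
  moreover have "h' p \<in> A" "h (h' p) = p" if "p \<in> B" for p
    using that ab by (auto simp: A_def B_def h_def h'_def partitions3_def)
  ultimately have "sum T B = (\<Sum>p\<in>A. T (h p))"
    by (intro sum.reindex_bij_witness[of _ h h']) auto
  then have "sum T A + sum T B = 0" using flip by (simp add: sum_negf)
  moreover have "sum T ?P = sum T (A \<union> B)"
    using fin zero by (intro sum.mono_neutral_right) (auto simp: A_def B_def)
  moreover have "sum T (A \<union> B) = sum T A + sum T B"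
    using fin by (intro sum.union_disjoint)
      (auto simp: A_def B_def partitions3_def elim!: finite_subset[rotated])
  ultimately have "sum T ?P = 0" by simp
  then show ?thesis
    by (simp add: poly ground T_def sum.distrib sum_subtractf)
qed

theorem theorem5p3:
  fixes D :: "'a set_sys" and a b :: 'a and s t :: "'r::comm_ring_1"
  assumes "binary_delta_matroid D"
    and "a \<in> ground D" and "b \<in> ground D" and "a \<noteq> b"
  shows "transition_poly s t D - transition_poly s t (first_move D a b)
           - transition_poly s t (second_move D a b) + transition_poly s t (both_moves D a b) = 0"
proof -
  from assms(1) have "set_system D"
    by (simp add: binary_delta_matroid_def delta_matroid_def)
  then show ?thesis using assms(2-4) by (rule transition_poly_four_term)
qed

end
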